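(* Let $B$ denote the bubble-sort operator. A permutation $\pi$ satisfies that $B(\pi)$ avoids the classical pattern $1243$ if and only if $\pi$ avoids all four of the following marked mesh patterns, each written as $(p; R; M)$ with $p$ the underlying classical pattern, $R$ the set of shaded boxes and $M$ the marked region, which must contain at least one entry: $$(1243;\ \emptyset;\ \{(0,4),(1,4),(2,4),(3,4)\}),$$ $$(1423;\ \{(0,4),(1,4),(2,4)\};\ \{(3,4)\}),$$ $$(2143;\ \{(0,2),(0,3),(0,4),(1,2),(1,3),(1,4)\};\ \{(2,4),(3,4)\}),$$ $$(4123;\ \{(0,4),(1,4),(2,4)\};\ \{(3,4)\}).$$ In other words, $B^{-1}(\mathrm{Av}(1243))$ is the set of permutations avoiding these four patterns, where $\mathrm{Av}(1243)$ is the set of permutations avoiding $1243$.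
   Context: Permutations are written in one-line notation $\pi(1)\cdots\pi(n)$. The bubble-sort operator $B$ performs one pass of bubble sort: for $i=1,2,\dots,n-1$ in this order, the entries currently in positions $i$ and $i+1$ are compared and swapped if the left one is larger than the right one; the result is $B(\pi)$. For example $B(52134)=21345$ and $B(521634)=215346$. Let $p$ be a permutation of length $k$ and $\pi$ a permutation of length $n$. An occurrence of the classical pattern $p$ in $\pi$ is a choice of positions $t_1<\dots<t_k$ such that $\pi(t_1),\dots,\pi(t_k)$ are in the same relative order as $p(1),\dots,p(k)$. Let $v_1<\dots<v_k$ be these values sorted increasingly, and put $t_0=v_0=0$, $t_{k+1}=v_{k+1}=n+1$. For $0\le i,j\le k$, the box $(i,j)$ of the occurrence is the set of points $(x,\pi(x))$ with $t_i<x<t_{i+1}$ and $v_j<\pi(x)<v_{j+1}$. An occurrence of the marked mesh pattern $(p;R;M)$ in $\pi$ is an occurrence of $p$ such that every box in $R$ is empty and the union of the boxes in $M$ contains at least one point. A permutation avoids a pattern if it has no occurrence of it. *)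

theory Defs
  imports "HOL-Combinatorics.Multiset_Permutations"
begin

text \<open>
  Permutations and patterns are given in one-line notation, as lists over \<open>{1..n}\<close>.
  Positions are counted from 1, so the entry at position \<open>i\<close> is \<open>\<pi> ! (i - 1)\<close>.
\<close>

definition perms :: "nat list set" where
  "perms = (\<Union>n. permutations_of_set {1..n})"

definition entry :: "nat list \<Rightarrow> nat \<Rightarrow> nat" where
  "entry \<pi> i = \<pi> ! (i - 1)"

definition bubble_step :: "nat \<Rightarrow> nat list \<Rightarrow> nat list" where
  "bubble_step i \<sigma> =
     (if entry \<sigma> i > entry \<sigma> (i + 1)
      then \<sigma>[i - 1 := entry \<sigma> (i + 1), i := entry \<sigma> i]
      else \<sigma>)"

definition bubble :: "nat list \<Rightarrow> nat list" where
  "bubble \<pi> = fold bubble_step [1..<length \<pi>] \<pi>"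

lemma "bubble [5,2,1,3,4] = [2,1,3,4,5]" "bubble [5,2,1,6,3,4] = [2,1,5,3,4,6]"
  by code_simp+

text \<open>An occurrence is represented by the increasing list \<open>ts\<close> of its positions.\<close>

definition occurrence :: "nat list \<Rightarrow> nat list \<Rightarrow> nat list \<Rightarrow> bool" where
  "occurrence p \<pi> ts \<longleftrightarrow>
     length ts = length p \<and> sorted_wrt (<) ts \<and> set ts \<subseteq> {1..length \<pi>} \<and>
     (\<forall>a<length p. \<forall>b<length p.
        entry \<pi> (ts ! a) < entry \<pi> (ts ! b) \<longleftrightarrow> p ! a < p ! b)"

definition avoids :: "nat list \<Rightarrow> nat list \<Rightarrow> bool" where
  "avoids \<pi> p \<longleftrightarrow> (\<nexists>ts. occurrence p \<pi> ts)"

definition Av :: "nat list \<Rightarrow> nat list set" where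
  "Av p = {\<pi> \<in> perms. avoids \<pi> p}"

text \<open>The list \<open>z\<^sub>0, z\<^sub>1, \<dots>, z\<^sub>k, z\<^sub>k\<^sub>+\<^sub>1\<close> with \<open>z\<^sub>0 = 0\<close> and \<open>z\<^sub>k\<^sub>+\<^sub>1 = n + 1\<close>.\<close>

definition grid :: "nat \<Rightarrow> nat list \<Rightarrow> nat list" where
  "grid n zs = 0 # zs @ [n + 1]"

definition box :: "nat list \<Rightarrow> nat list \<Rightarrow> nat \<times> nat \<Rightarrow> (nat \<times> nat) set" where
  "box \<pi> ts = (\<lambda>(i, j).
     let t = grid (length \<pi>) ts;
         v = grid (length \<pi>) (sort (map (entry \<pi>) ts))
     in {(x, entry \<pi> x) | x.
           x \<in> {1..length \<pi>} \<and> t ! i < x \<and> x < t ! (i + 1) \<and>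
           v ! j < entry \<pi> x \<and> entry \<pi> x < v ! (j + 1)})"

text \<open>A marked mesh pattern \<open>(p, R, M)\<close> has shaded boxes \<open>R\<close> and marked region \<open>M\<close>.\<close>

type_synonym marked_mesh = "nat list \<times> (nat \<times> nat) set \<times> (nat \<times> nat) set"

definition mesh_occurrence :: "marked_mesh \<Rightarrow> nat list \<Rightarrow> nat list \<Rightarrow> bool" where
  "mesh_occurrence = (\<lambda>(p, R, M) \<pi> ts.
     occurrence p \<pi> ts \<and>
     (\<forall>b\<in>R. box \<pi> ts b = {}) \<and>
     (\<Union>b\<in>M. box \<pi> ts b) \<noteq> {})"

definition mesh_avoids :: "nat list \<Rightarrow> marked_mesh \<Rightarrow> bool" where
  "mesh_avoids \<pi> P \<longleftrightarrow> (\<nexists>ts. mesh_occurrence P \<pi> ts)"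

definition patterns_1243 :: "marked_mesh set" where
  "patterns_1243 =
     {([1,2,4,3], {}, {(0,4), (1,4), (2,4), (3,4)}),
      ([1,4,2,3], {(0,4), (1,4), (2,4)}, {(3,4)}),
      ([2,1,4,3], {(0,2), (0,3), (0,4), (1,2), (1,3), (1,4)}, {(2,4), (3,4)}),
      ([4,1,2,3], {(0,4), (1,4), (2,4)}, {(3,4)})}"

end

theory Submission
  imports Defs
begin

text \<open>
  One pass of bubble sort never creates an inversion, and it keeps an inversion \<open>b \<dots> a\<close> (with
  \<open>a < b\<close>) exactly when some entry larger than \<open>b\<close> precedes \<open>a\<close>: otherwise \<open>b\<close> is the
  entry being carried when \<open>a\<close> is reached. So \<open>B(\<pi>)\<close> contains \<open>1243\<close>, with values
  \<open>a < b < c < d\<close>, iff in \<open>\<pi>\<close> the value \<open>d\<close> and a value above \<open>d\<close> precede \<open>c\<close>, and each of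
  the pairs \<open>a, b\<close> and \<open>b, d\<close> is either in order or is an inversion that the pass removes.
  The four possible relative orders of \<open>a, b, d\<close> in \<open>\<pi>\<close> give the four mesh patterns.
\<close>

section \<open>One pass as a recursion that carries the running maximum\<close>

fun carry :: "'a::linorder \<Rightarrow> 'a list \<Rightarrow> 'a list" where
  "carry x [] = [x]"
| "carry x (y # ys) = min x y # carry (max x y) ys"

lemma mset_carry [simp]: "mset (carry x xs) = add_mset x (mset xs)"
  by (induction xs arbitrary: x) (auto simp: min_def max_def)

lemma set_carry [simp]: "set (carry x xs) = insert x (set xs)"
  by (metis mset_carry set_mset_mset set_mset_add_mset_insert)

text \<open>The entries of \<open>us\<close> are final, and \<open>x\<close>, at 1-based position
  \<open>Suc (length us)\<close>, is the entry being carried. The prefix stays general because every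
  step appends \<open>min x y\<close> to it.\<close>

lemma fold_bubble_step:
  "fold bubble_step [Suc (length us)..<Suc (length us + length xs)] (us @ x # xs) = us @ carry x xs"
proof (induction xs arbitrary: us x)
  case (Cons y ys)
  have "bubble_step (Suc (length us)) (us @ x # y # ys) = (us @ [min x y]) @ max x y # ys"
    by (auto simp: bubble_step_def entry_def nth_append list_update_append min_def max_def)
  then show ?case
    using Cons.IH [of "us @ [min x y]" "max x y"] by (subst upt_conv_Cons) auto
qed auto

lemma bubble_Cons: "bubble (x # xs) = carry x xs"
  using fold_bubble_step [of "[]" xs x] by (simp add: bubble_def)

lemma mset_bubble: "mset (bubble \<pi>) = mset \<pi>"
  by (cases \<pi>) (simp_all add: bubble_Cons, simp add: bubble_def)

section \<open>Relative order of values before and after a pass\<close>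

text \<open>Order is recorded by value rather than by position: the pass moves entries but keeps the
  set of values, so both lists can be compared directly.\<close>

primrec precedes :: "'a list \<Rightarrow> 'a \<Rightarrow> 'a \<Rightarrow> bool" where
  "precedes [] a b \<longleftrightarrow> False"
| "precedes (x # xs) a b \<longleftrightarrow> x = a \<and> b \<in> set xs \<or> precedes xs a b"

lemma precedes_in_set: "precedes xs a b \<Longrightarrow> a \<in> set xs \<and> b \<in> set xs"
  by (induction xs) auto

lemma precedes_total:
  "distinct xs \<Longrightarrow> a \<in> set xs \<Longrightarrow> b \<in> set xs \<Longrightarrow> a \<noteq> b \<Longrightarrow> precedes xs a b \<longleftrightarrow> \<not> precedes xs b a"
  by (induction xs) (auto dest: precedes_in_set)

lemma precedes_nth:
  "distinct xs \<Longrightarrow> i < length xs \<Longrightarrow> j < length xs \<Longrightarrow> precedes xs (xs ! i) (xs ! j) \<longleftrightarrow> i < j"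
proof (induction xs arbitrary: i j)
  case (Cons x xs)
  then show ?case
    by (cases i; cases j) (auto dest: precedes_in_set)
qed auto

text \<open>Each comparison outputs \<open>min x y\<close>, and the induction hypothesis applies to
  the list headed by \<open>max x y\<close>. If the output is \<open>b\<close> itself, then
  \<open>max x y\<close> is the required larger entry ahead of \<open>a\<close>.\<close>

lemma precedes_carry:
  assumes "distinct (x # xs)" and "a < b"
  shows "precedes (carry x xs) b a \<longleftrightarrow>
    precedes (x # xs) b a \<and> (\<exists>c>b. precedes (x # xs) c a)"
  using assms
proof (induction xs arbitrary: x)
  case (Cons y ys)
  have "distinct (max x y # ys)"
    using Cons.prems by (auto simp: max_def)
  note IH = Cons.IH [OF this \<open>a < b\<close>]
  show ?case
  proof (cases "x < y")
    case True
    \<comment> \<open>The output \<open>x\<close> is missing from the list of the induction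
      hypothesis. If it served as the larger entry \<open>c\<close>, then \<open>y\<close> replaces
      it; in the other case the roles of \<open>x\<close> and \<open>y\<close> are
      exchanged.\<close>
    then have "b < x \<Longrightarrow> b < y"
      by simp
    with True IH Cons.prems show ?thesis
      by (auto dest: precedes_in_set simp: min_def max_def)
  next
    case False
    with Cons.prems have "y < x" "b < y \<Longrightarrow> b < x"
      by auto
    with IH Cons.prems show ?thesis
      by (auto dest: precedes_in_set simp: min_def max_def)
  qed
qed auto

section \<open>Translation to positions in the original permutation\<close>

abbreviation positions :: "nat list \<Rightarrow> nat set" where
  "positions \<pi> \<equiv> {1..length \<pi>}"

lemma set_eq_entry_image: "set \<pi> = entry \<pi> ` positions \<pi>"
proof -
  have "positions \<pi> = Suc ` {0..<length \<pi>}"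
    by (simp only: image_Suc_atLeastLessThan atLeastLessThanSuc_atLeastAtMost One_nat_def)
  moreover have "set \<pi> = (!) \<pi> ` {0..<length \<pi>}"
    by (auto simp: set_conv_nth)
  ultimately show ?thesis
    by (simp only: image_image entry_def diff_Suc_1)
qed

lemma in_set_iff_entry: "a \<in> set \<pi> \<longleftrightarrow> (\<exists>i\<in>positions \<pi>. a = entry \<pi> i)"
  unfolding set_eq_entry_image by blast

lemma precedes_entry:
  assumes "distinct \<pi>" "i \<in> positions \<pi>" "j \<in> positions \<pi>"
  shows "precedes \<pi> (entry \<pi> i) (entry \<pi> j) \<longleftrightarrow> i < j"
  using assms by (auto simp: entry_def precedes_nth)

lemma bubble_inversion:
  assumes "distinct \<pi>" "i \<in> positions \<pi>" "j \<in> positions \<pi>" "entry \<pi> j < entry \<pi> i"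
  shows "precedes (bubble \<pi>) (entry \<pi> i) (entry \<pi> j) \<longleftrightarrow>
    i < j \<and> (\<exists>m\<in>positions \<pi>. m < j \<and> entry \<pi> i < entry \<pi> m)"
proof -
  have "precedes (bubble \<pi>) (entry \<pi> i) (entry \<pi> j) \<longleftrightarrow>
    precedes \<pi> (entry \<pi> i) (entry \<pi> j) \<and> (\<exists>c>entry \<pi> i. precedes \<pi> c (entry \<pi> j))"
  proof (cases \<pi>)
    case Nil
    then show ?thesis using assms by auto
  next
    case (Cons x xs)
    with assms precedes_carry [of x xs] show ?thesis
      by (simp only: bubble_Cons)
  qed
  moreover have "(\<exists>c>entry \<pi> i. precedes \<pi> c (entry \<pi> j)) \<longleftrightarrow>
    (\<exists>m\<in>positions \<pi>. m < j \<and> entry \<pi> i < entry \<pi> m)"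
    using assms by (metis in_set_iff_entry precedes_entry precedes_in_set)
  ultimately show ?thesis
    using assms by (simp add: precedes_entry)
qed

text \<open>This is the complement of \<open>bubble_inversion\<close> with \<open>i\<close> and
  \<open>j\<close> exchanged, since the values are totally ordered by \<open>precedes\<close>. The
  second disjunct covers an inversion that the pass removes.\<close>

lemma bubble_noninversion:
  assumes "distinct \<pi>" "i \<in> positions \<pi>" "j \<in> positions \<pi>" "entry \<pi> i < entry \<pi> j"
  shows "precedes (bubble \<pi>) (entry \<pi> i) (entry \<pi> j) \<longleftrightarrow>
    i < j \<or> (\<forall>m\<in>positions \<pi>. m < i \<longrightarrow> entry \<pi> m \<le> entry \<pi> j)"
proof -
  have "distinct (bubble \<pi>)" "set (bubble \<pi>) = set \<pi>"
    using mset_bubble [of \<pi>] assms(1) by (metis mset_eq_imp_distinct_iff, metis set_mset_mset)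
  then have "precedes (bubble \<pi>) (entry \<pi> i) (entry \<pi> j) \<longleftrightarrow>
      \<not> precedes (bubble \<pi>) (entry \<pi> j) (entry \<pi> i)"
    using assms by (intro precedes_total) (auto simp: in_set_iff_entry)
  moreover have "i \<noteq> j"
    using assms by auto
  ultimately show ?thesis
    using assms by (auto simp: bubble_inversion not_less)
qed

section \<open>Occurrences of patterns of length four\<close>

lemma occurrence_four:
  "occurrence [p1, p2, p3, p4] \<pi> ts \<longleftrightarrow> (\<exists>t1\<in>positions \<pi>. \<exists>t2\<in>positions \<pi>. \<exists>t3\<in>positions \<pi>. \<exists>t4\<in>positions \<pi>.
     ts = [t1, t2, t3, t4] \<and> t1 < t2 \<and> t2 < t3 \<and> t3 < t4 \<and>
     (\<forall>a<4. \<forall>b<4. entry \<pi> ([t1, t2, t3, t4] ! a) < entry \<pi> ([t1, t2, t3, t4] ! b) \<longleftrightarrow>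
        [p1, p2, p3, p4] ! a < [p1, p2, p3, p4] ! b))" (is "?L \<longleftrightarrow> ?R")
proof
  assume L: ?L
  then have "length ts = Suc (Suc (Suc (Suc 0)))"
    by (simp add: occurrence_def)
  then obtain t1 t2 t3 t4 where "ts = [t1, t2, t3, t4]"
    by (auto simp: length_Suc_conv)
  with L show ?R
    by (simp add: occurrence_def)
next
  assume ?R
  then show ?L
    by (fastforce simp: occurrence_def)
qed

text \<open>\<open>4\<close> becomes a successor, so that the bounded quantifiers over indices
  expand into single comparisons.\<close>

lemmas four_simps = All_less_Suc numeral_eq_Suc

text \<open>From here on \<open>i\<close>, \<open>j\<close>, \<open>k\<close>, \<open>l\<close> are
  the positions of the values playing 1, 2, 3, 4; an occurrence of 1243 thus reads \<open>i\<close>,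
  \<open>j\<close>, \<open>l\<close>, \<open>k\<close> from left to right.\<close>

lemma avoids_1243_iff:
  assumes "distinct \<sigma>"
  shows "avoids \<sigma> [1, 2, 4, 3] \<longleftrightarrow> \<not> (\<exists>a b c d. a < b \<and> b < c \<and> c < d \<and>
    precedes \<sigma> a b \<and> precedes \<sigma> b d \<and> precedes \<sigma> d c)" (is "_ \<longleftrightarrow> \<not> ?R")
proof -
  have "(\<exists>ts. occurrence [1, 2, 4, 3] \<sigma> ts) \<longleftrightarrow>
    (\<exists>i\<in>positions \<sigma>. \<exists>j\<in>positions \<sigma>. \<exists>l\<in>positions \<sigma>. \<exists>k\<in>positions \<sigma>.
      i < j \<and> j < l \<and> l < k \<and> entry \<sigma> i < entry \<sigma> j \<and> entry \<sigma> j < entry \<sigma> k \<and> entry \<sigma> k < entry \<sigma> l)"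
    unfolding occurrence_four by (simp add: four_simps) (smt (verit) less_trans less_asym)
  also have "\<dots> \<longleftrightarrow> ?R"
    using assms by (smt (verit) in_set_iff_entry precedes_in_set precedes_entry)
  finally show ?thesis
    by (simp add: avoids_def)
qed

lemma avoids_bubble_iff:
  assumes "distinct \<pi>"
  shows "avoids (bubble \<pi>) [1, 2, 4, 3] \<longleftrightarrow> \<not> (\<exists>i\<in>positions \<pi>. \<exists>j\<in>positions \<pi>. \<exists>k\<in>positions \<pi>. \<exists>l\<in>positions \<pi>.
    entry \<pi> i < entry \<pi> j \<and> entry \<pi> j < entry \<pi> k \<and> entry \<pi> k < entry \<pi> l \<and>
    (i < j \<or> (\<forall>m\<in>positions \<pi>. m < i \<longrightarrow> entry \<pi> m \<le> entry \<pi> j)) \<and>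
    (j < l \<or> (\<forall>m\<in>positions \<pi>. m < j \<longrightarrow> entry \<pi> m \<le> entry \<pi> l)) \<and>
    l < k \<and> (\<exists>m\<in>positions \<pi>. m < k \<and> entry \<pi> l < entry \<pi> m))"
proof -
  have *: "distinct (bubble \<pi>)" "set (bubble \<pi>) = set \<pi>"
    using mset_bubble [of \<pi>] assms(1) by (metis mset_eq_imp_distinct_iff, metis set_mset_mset)
  have "(\<exists>a b c d. a < b \<and> b < c \<and> c < d \<and>
      precedes (bubble \<pi>) a b \<and> precedes (bubble \<pi>) b d \<and> precedes (bubble \<pi>) d c) \<longleftrightarrow>
    (\<exists>a\<in>set \<pi>. \<exists>b\<in>set \<pi>. \<exists>c\<in>set \<pi>. \<exists>d\<in>set \<pi>. a < b \<and> b < c \<and> c < d \<and>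
      precedes (bubble \<pi>) a b \<and> precedes (bubble \<pi>) b d \<and> precedes (bubble \<pi>) d c)"
    unfolding *(2) [symmetric] by (blast dest: precedes_in_set)
  \<comment> \<open>The values are named by their positions in \<open>\<pi>\<close>, although their
    order is still read in \<open>bubble \<pi>\<close>.\<close>
  also have "\<dots> \<longleftrightarrow> (\<exists>i\<in>positions \<pi>. \<exists>j\<in>positions \<pi>. \<exists>k\<in>positions \<pi>. \<exists>l\<in>positions \<pi>.
    entry \<pi> i < entry \<pi> j \<and> entry \<pi> j < entry \<pi> k \<and> entry \<pi> k < entry \<pi> l \<and>
      precedes (bubble \<pi>) (entry \<pi> i) (entry \<pi> j) \<and> precedes (bubble \<pi>) (entry \<pi> j) (entry \<pi> l) \<and>
      precedes (bubble \<pi>) (entry \<pi> l) (entry \<pi> k))"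
    by (simp only: set_eq_entry_image bex_simps)
  also have "\<dots> \<longleftrightarrow> (\<exists>i\<in>positions \<pi>. \<exists>j\<in>positions \<pi>. \<exists>k\<in>positions \<pi>. \<exists>l\<in>positions \<pi>.
    entry \<pi> i < entry \<pi> j \<and> entry \<pi> j < entry \<pi> k \<and> entry \<pi> k < entry \<pi> l \<and>
    (i < j \<or> (\<forall>m\<in>positions \<pi>. m < i \<longrightarrow> entry \<pi> m \<le> entry \<pi> j)) \<and>
    (j < l \<or> (\<forall>m\<in>positions \<pi>. m < j \<longrightarrow> entry \<pi> m \<le> entry \<pi> l)) \<and>
    l < k \<and> (\<exists>m\<in>positions \<pi>. m < k \<and> entry \<pi> l < entry \<pi> m))"
  \<comment> \<open>The pairs \<open>i\<close>, \<open>j\<close> and \<open>j\<close>,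
    \<open>l\<close> must be in order after the pass, while \<open>l\<close>, \<open>k\<close> must
    be an inversion that survives it.\<close>
  proof (intro bex_cong refl conj_cong, goal_cases)
    case (1 i j k l)
    then show ?case by (intro bubble_noninversion assms)
  next
    case (2 i j k l)
    then show ?case by (intro bubble_noninversion assms) auto
  next
    case (3 i j k l)
    then show ?case by (intro bubble_inversion assms)
  qed
  finally show ?thesis
    unfolding avoids_1243_iff [OF *(1)] by (rule arg_cong)
qed

section \<open>Shaded and marked boxes as bounds on positions and values\<close>

lemma box_empty_iff:
  "box \<pi> ts (i, j) = {} \<longleftrightarrow> (\<forall>x\<in>positions \<pi>. \<not> (grid (length \<pi>) ts ! i < x \<and>
     x < grid (length \<pi>) ts ! Suc i \<and>
     grid (length \<pi>) (sort (map (entry \<pi>) ts)) ! j < entry \<pi> x \<and>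
     entry \<pi> x < grid (length \<pi>) (sort (map (entry \<pi>) ts)) ! Suc j))"
  unfolding box_def Let_def by auto

text \<open>The marking is phrased as a negated emptiness condition, so that
  \<open>box_empty_iff\<close> rewrites it as well as the shading.\<close>

lemma mesh_occurrence_four:
  "(\<exists>ts. mesh_occurrence ([p1, p2, p3, p4], R, M) \<pi> ts) \<longleftrightarrow>
    (\<exists>t1\<in>positions \<pi>. \<exists>t2\<in>positions \<pi>. \<exists>t3\<in>positions \<pi>. \<exists>t4\<in>positions \<pi>.
     t1 < t2 \<and> t2 < t3 \<and> t3 < t4 \<and>
     (\<forall>a<4. \<forall>b<4. entry \<pi> ([t1, t2, t3, t4] ! a) < entry \<pi> ([t1, t2, t3, t4] ! b) \<longleftrightarrow>
        [p1, p2, p3, p4] ! a < [p1, p2, p3, p4] ! b) \<and>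
     (\<forall>b\<in>R. box \<pi> [t1, t2, t3, t4] b = {}) \<and> \<not> (\<forall>b\<in>M. box \<pi> [t1, t2, t3, t4] b = {}))"
proof -
  have "(\<Union>b\<in>M. box \<pi> ts b) \<noteq> {} \<longleftrightarrow> \<not> (\<forall>b\<in>M. box \<pi> ts b = {})" for ts
    by blast
  then show ?thesis
    unfolding mesh_occurrence_def occurrence_four prod.case by blast
qed

text \<open>Values stay below the top grid line, so lying in row 4 just means exceeding the largest
  entry of the occurrence. Injectivity keeps points at other positions off the horizontal grid
  lines.\<close>

context
  fixes \<pi> :: "nat list"
  assumes entry_less: "\<And>x. x \<in> positions \<pi> \<Longrightarrow> entry \<pi> x < Suc (length \<pi>)"
    and inj: "inj_on (entry \<pi>) (positions \<pi>)"
begin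

lemma entry_eq_iff: "x \<in> positions \<pi> \<Longrightarrow> y \<in> positions \<pi> \<Longrightarrow> entry \<pi> x = entry \<pi> y \<longleftrightarrow> x = y"
  using inj by (rule inj_on_eq_iff)

text \<open>The marked boxes fill the region left of \<open>k\<close> and above the entry at
  \<open>l\<close>, except for the vertical lines through \<open>i\<close>, \<open>j\<close>,
  \<open>l\<close>. The entries on these lines are too small to lie in the region.\<close>

lemma mesh_occurrence_1243:
  "(\<exists>ts. mesh_occurrence ([1,2,4,3], {}, {(0,4), (1,4), (2,4), (3,4)}) \<pi> ts) \<longleftrightarrow>
    (\<exists>i\<in>positions \<pi>. \<exists>j\<in>positions \<pi>. \<exists>l\<in>positions \<pi>. \<exists>k\<in>positions \<pi>.
      i < j \<and> j < l \<and> l < k \<and>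
      (entry \<pi> i < entry \<pi> j \<and> entry \<pi> j < entry \<pi> k \<and> entry \<pi> k < entry \<pi> l) \<and>
      (\<exists>m\<in>positions \<pi>. m < k \<and> entry \<pi> l < entry \<pi> m))"
  unfolding mesh_occurrence_four
proof (intro bex_cong refl conj_cong, goal_cases)
  case (2 i j l k)
  then show ?case
  proof (simp add: box_empty_iff grid_def flip: bex_disj_distrib, intro bex_cong refl, goal_cases)
    case (1 x)
    then show ?case
      using entry_less [of x] by (cases "x = i"; cases "x = j"; cases "x = l") auto
  qed
qed (auto simp: four_simps)

text \<open>The shading leaves nothing above the entry at \<open>l\<close> to the left of
  \<open>j\<close>. A larger entry left of \<open>k\<close> is therefore the same as one between
  \<open>j\<close> and \<open>k\<close>, which is the marked box.\<close>

lemma mesh_occurrence_1423: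
  "(\<exists>ts. mesh_occurrence ([1,4,2,3], {(0,4), (1,4), (2,4)}, {(3,4)}) \<pi> ts) \<longleftrightarrow>
    (\<exists>i\<in>positions \<pi>. \<exists>l\<in>positions \<pi>. \<exists>j\<in>positions \<pi>. \<exists>k\<in>positions \<pi>.
      i < l \<and> l < j \<and> j < k \<and>
      (entry \<pi> i < entry \<pi> j \<and> entry \<pi> j < entry \<pi> k \<and> entry \<pi> k < entry \<pi> l) \<and>
      (\<forall>m\<in>positions \<pi>. m < j \<longrightarrow> entry \<pi> m \<le> entry \<pi> l) \<and>
      (\<exists>m\<in>positions \<pi>. m < k \<and> entry \<pi> l < entry \<pi> m))"
  unfolding mesh_occurrence_four
proof (intro bex_cong refl conj_cong, goal_cases)
  case (2 i l j k)
  then show ?case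
  proof (simp add: box_empty_iff grid_def flip: ball_conj_distrib, intro ball_cong refl, goal_cases)
    case (1 x)
    then show ?case
      using entry_less [of x] by (cases "x = i"; cases "x = l") auto
  qed
next
  case (3 i l j k)
  then show ?case
  proof (simp add: box_empty_iff grid_def flip: bex_disj_distrib, intro bex_cong refl, goal_cases)
    case (1 x)
    \<comment> \<open>\<open>conj_cong\<close> has put the rewritten shading condition among the
      premises. It excludes \<open>x < j\<close>, and at \<open>x = j\<close> the entry is too
      small.\<close>
    then have "entry \<pi> l < entry \<pi> x \<Longrightarrow> j < x"
      by (cases x j rule: linorder_cases) (auto dest!: bspec [of _ _ x])
    with 1 show ?case
      using entry_less [of x] by auto
  qed
qed (auto simp: four_simps)

text \<open>The six shaded boxes fill the region left of \<open>i\<close> and above the entry at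
  \<open>j\<close>, cut by the vertical line through \<open>j\<close> and the horizontal lines of
  the entries at \<open>k\<close> and \<open>l\<close>.\<close>

lemma mesh_occurrence_2143:
  "(\<exists>ts. mesh_occurrence ([2,1,4,3], {(0,2), (0,3), (0,4), (1,2), (1,3), (1,4)}, {(2,4), (3,4)}) \<pi> ts) \<longleftrightarrow>
    (\<exists>j\<in>positions \<pi>. \<exists>i\<in>positions \<pi>. \<exists>l\<in>positions \<pi>. \<exists>k\<in>positions \<pi>.
      j < i \<and> i < l \<and> l < k \<and>
      (entry \<pi> i < entry \<pi> j \<and> entry \<pi> j < entry \<pi> k \<and> entry \<pi> k < entry \<pi> l) \<and>
      (\<forall>m\<in>positions \<pi>. m < i \<longrightarrow> entry \<pi> m \<le> entry \<pi> j) \<and>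
      (\<exists>m\<in>positions \<pi>. m < k \<and> entry \<pi> l < entry \<pi> m))"
  unfolding mesh_occurrence_four
proof (intro bex_cong refl conj_cong, goal_cases)
  case (2 j i l k)
  then show ?case
  proof (simp add: box_empty_iff grid_def flip: ball_conj_distrib, intro ball_cong refl, goal_cases)
    case (1 x)
    show ?case
    proof (cases "x < i \<and> entry \<pi> j < entry \<pi> x")
      case True
      \<comment> \<open>No cut passes through the point at \<open>x\<close>: \<open>k\<close> and
        \<open>l\<close> lie to the right of \<open>i\<close>, and \<open>j\<close> has a smaller
        entry. Hence the point is inside one of the six boxes.\<close>
      with 1 have "entry \<pi> x \<noteq> entry \<pi> k" "entry \<pi> x \<noteq> entry \<pi> l" "x \<noteq> j"
        by (auto simp: entry_eq_iff)
      then consider "entry \<pi> x < entry \<pi> k" | "entry \<pi> k < entry \<pi> x" "entry \<pi> x < entry \<pi> l"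
        | "entry \<pi> l < entry \<pi> x"
        by linarith
      moreover have "x < j \<or> j < x"
        using \<open>x \<noteq> j\<close> by linarith
      moreover have "entry \<pi> x < Suc (length \<pi>)"
        using 1 by (intro entry_less) simp
      ultimately show ?thesis
        using True by cases auto
    next
      case False
      \<comment> \<open>Rows 3 and 4 lie above the entry at \<open>j\<close> too, so none of the six
        boxes contains the point.\<close>
      with 1 have "\<not> (x < i \<and> entry \<pi> k < entry \<pi> x)" "\<not> (x < i \<and> entry \<pi> l < entry \<pi> x)" "x < j \<Longrightarrow> x < i"
        by auto
      with False show ?thesis
        by (cases "x < i"; cases "x < j") simp_all
    qed
  qed
next
  case (3 j i l k)
  then show ?case
  proof (simp add: box_empty_iff grid_def flip: bex_disj_distrib, intro bex_cong refl, goal_cases)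
    case (1 x)
    \<comment> \<open>The shading pushes a larger entry to the right of \<open>i\<close>. The line
      through \<open>l\<close> between the two marked boxes carries no such entry.\<close>
    then have "entry \<pi> l < entry \<pi> x \<Longrightarrow> i < x"
      by (cases x i rule: linorder_cases) (auto dest!: bspec [of _ _ x])
    with 1 show ?case
      using entry_less [of x] by (cases "x = l") auto
  qed
qed (auto simp: four_simps)

text \<open>The argument for 1423 carries over: only \<open>j\<close>, \<open>k\<close> and the
  value at \<open>l\<close> enter into the shading and marking conditions, and \<open>i\<close> and
  \<open>l\<close> both lie left of \<open>j\<close>.\<close>

lemma mesh_occurrence_4123:
  "(\<exists>ts. mesh_occurrence ([4,1,2,3], {(0,4), (1,4), (2,4)}, {(3,4)}) \<pi> ts) \<longleftrightarrow>
    (\<exists>l\<in>positions \<pi>. \<exists>i\<in>positions \<pi>. \<exists>j\<in>positions \<pi>. \<exists>k\<in>positions \<pi>.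
      l < i \<and> i < j \<and> j < k \<and>
      (entry \<pi> i < entry \<pi> j \<and> entry \<pi> j < entry \<pi> k \<and> entry \<pi> k < entry \<pi> l) \<and>
      (\<forall>m\<in>positions \<pi>. m < j \<longrightarrow> entry \<pi> m \<le> entry \<pi> l) \<and>
      (\<exists>m\<in>positions \<pi>. m < k \<and> entry \<pi> l < entry \<pi> m))"
  unfolding mesh_occurrence_four
proof (intro bex_cong refl conj_cong, goal_cases)
  case (2 l i j k)
  then show ?case
  proof (simp add: box_empty_iff grid_def flip: ball_conj_distrib, intro ball_cong refl, goal_cases)
    case (1 x)
    then show ?case
      using entry_less [of x] by (cases "x = i"; cases "x = l") auto
  qed
next
  case (3 l i j k)
  then show ?case
  proof (simp add: box_empty_iff grid_def flip: bex_disj_distrib, intro bex_cong refl, goal_cases)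
    case (1 x)
    then have "entry \<pi> l < entry \<pi> x \<Longrightarrow> j < x"
      by (cases x j rule: linorder_cases) (auto dest!: bspec [of _ _ x])
    with 1 show ?case
      using entry_less [of x] by auto
  qed
qed (auto simp: four_simps)

end

section \<open>Case distinction on the order of the positions\<close>

text \<open>If \<open>j < i\<close>, then nothing left of \<open>i\<close> exceeds
  \<open>e j\<close>, which forces \<open>i < l\<close>. This rules out two of the six orders of
  \<open>i\<close>, \<open>j\<close>, \<open>l\<close>; the other four give the four
  disjuncts.\<close>

lemma relative_order_cases:
  fixes e :: "nat \<Rightarrow> nat"
  shows "(\<exists>i\<in>P. \<exists>j\<in>P. \<exists>k\<in>P. \<exists>l\<in>P. e i < e j \<and> e j < e k \<and> e k < e l \<and>
      (i < j \<or> (\<forall>m\<in>P. m < i \<longrightarrow> e m \<le> e j)) \<and> (j < l \<or> (\<forall>m\<in>P. m < j \<longrightarrow> e m \<le> e l)) \<and>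
      l < k \<and> (\<exists>m\<in>P. m < k \<and> e l < e m)) \<longleftrightarrow>
    (\<exists>i\<in>P. \<exists>j\<in>P. \<exists>l\<in>P. \<exists>k\<in>P. i < j \<and> j < l \<and> l < k \<and>
      (e i < e j \<and> e j < e k \<and> e k < e l) \<and>
      (\<exists>m\<in>P. m < k \<and> e l < e m)) \<or>
    (\<exists>i\<in>P. \<exists>l\<in>P. \<exists>j\<in>P. \<exists>k\<in>P. i < l \<and> l < j \<and> j < k \<and>
      (e i < e j \<and> e j < e k \<and> e k < e l) \<and>
      (\<forall>m\<in>P. m < j \<longrightarrow> e m \<le> e l) \<and> (\<exists>m\<in>P. m < k \<and> e l < e m)) \<or>
    (\<exists>j\<in>P. \<exists>i\<in>P. \<exists>l\<in>P. \<exists>k\<in>P. j < i \<and> i < l \<and> l < k \<and>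
      (e i < e j \<and> e j < e k \<and> e k < e l) \<and>
      (\<forall>m\<in>P. m < i \<longrightarrow> e m \<le> e j) \<and> (\<exists>m\<in>P. m < k \<and> e l < e m)) \<or>
    (\<exists>l\<in>P. \<exists>i\<in>P. \<exists>j\<in>P. \<exists>k\<in>P. l < i \<and> i < j \<and> j < k \<and>
      (e i < e j \<and> e j < e k \<and> e k < e l) \<and>
      (\<forall>m\<in>P. m < j \<longrightarrow> e m \<le> e l) \<and> (\<exists>m\<in>P. m < k \<and> e l < e m))"
    (is "?A \<longleftrightarrow> ?C1 \<or> ?C2 \<or> ?C3 \<or> ?C4")
proof (rule iffI)
  assume ?A
  then obtain i j k l m where pos: "i \<in> P" "j \<in> P" "k \<in> P" "l \<in> P" "m \<in> P"
    and val: "e i < e j" "e j < e k" "e k < e l"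
    and ij: "i < j \<or> (\<forall>m\<in>P. m < i \<longrightarrow> e m \<le> e j)"
    and jl: "j < l \<or> (\<forall>m\<in>P. m < j \<longrightarrow> e m \<le> e l)"
    and "l < k" and m: "m < k" "e l < e m"
    by blast
  have neq: "i \<noteq> j" "i \<noteq> l" "j \<noteq> l" "j \<noteq> k"
    using val by auto
  consider "i < j" "j < l" | "i < j" "l < j" | "j < i"
    using neq by linarith
  then show "?C1 \<or> ?C2 \<or> ?C3 \<or> ?C4"
  proof cases
    case 1
    then have ?C1
      using pos val \<open>l < k\<close> m by blast
    then show ?thesis ..
  next
    case 2
    then have N: "\<forall>m\<in>P. m < j \<longrightarrow> e m \<le> e l"
      using jl by auto
    \<comment> \<open>The entry at \<open>m\<close> exceeds \<open>e l\<close>, so by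
      \<open>N\<close> it is not left of \<open>j\<close>; hence
      \<open>j \<le> m < k\<close>.\<close>
    have "j < k"
      using N m \<open>m \<in> P\<close> neq by (metis leD less_trans nat_neq_iff)
    consider "i < l" | "l < i"
      using neq by linarith
    then show ?thesis
    proof cases
      case 1
      then have ?C2
        using pos val m N \<open>l < j\<close> \<open>j < k\<close> by blast
      then show ?thesis by (intro disjI2 disjI1)
    next
      case 2
      then have ?C4
        using pos val m N \<open>i < j\<close> \<open>j < k\<close> by blast
      then show ?thesis by (intro disjI2)
    qed
  next
    case 3
    then have N: "\<forall>m\<in>P. m < i \<longrightarrow> e m \<le> e j"
      using ij by auto
    have "\<not> l < i"
      using N val \<open>l \<in> P\<close> by force
    then have "i < l"
      using neq by linarith
    then have ?C3
      using pos val m N \<open>j < i\<close> \<open>l < k\<close> by blast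
    then show ?thesis by (intro disjI2 disjI1)
  qed
next
  assume "?C1 \<or> ?C2 \<or> ?C3 \<or> ?C4"
  then show ?A
  proof (elim disjE)
    assume ?C1 then show ?A by blast
  next
    assume ?C2
    then obtain i j k l m where "i \<in> P" "j \<in> P" "k \<in> P" "l \<in> P" "m \<in> P"
      "e i < e j" "e j < e k" "e k < e l" "i < l" "l < j" "j < k"
      "\<forall>m\<in>P. m < j \<longrightarrow> e m \<le> e l" "m < k" "e l < e m"
      by blast
    \<comment> \<open>The required \<open>l < k\<close> comes through \<open>j\<close>, and the
      second alternative for \<open>j\<close> and \<open>l\<close> is the one satisfied.\<close>
    moreover from this have "i < j" "l < k"
      by linarith+
    ultimately show ?A by blast
  next
    assume ?C3
    then obtain i j k l m where "i \<in> P" "j \<in> P" "k \<in> P" "l \<in> P" "m \<in> P"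
      "e i < e j" "e j < e k" "e k < e l" "j < i" "i < l" "l < k"
      "\<forall>m\<in>P. m < i \<longrightarrow> e m \<le> e j" "m < k" "e l < e m"
      by blast
    moreover from this have "j < l"
      by linarith
    ultimately show ?A by blast
  next
    assume ?C4
    then obtain i j k l m where "i \<in> P" "j \<in> P" "k \<in> P" "l \<in> P" "m \<in> P"
      "e i < e j" "e j < e k" "e k < e l" "l < i" "i < j" "j < k"
      "\<forall>m\<in>P. m < j \<longrightarrow> e m \<le> e l" "m < k" "e l < e m"
      by blast
    moreover from this have "l < k"
      by linarith
    ultimately show ?A by blast
  qed
qed

section \<open>Assembly of the characterisation\<close>

lemma avoids_bubble_1243_iff_mesh:
  assumes "\<pi> \<in> perms"
  shows "avoids (bubble \<pi>) [1, 2, 4, 3] \<longleftrightarrow> (\<forall>P\<in>patterns_1243. mesh_avoids \<pi> P)"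
proof -
  obtain n where "distinct \<pi>" and "set \<pi> = {1..n}"
    using assms by (auto simp: perms_def permutations_of_set_def)
  then have "length \<pi> = n"
    using distinct_card by fastforce
  have less: "entry \<pi> x < Suc (length \<pi>)" if "x \<in> positions \<pi>" for x
    using that in_set_iff_entry \<open>set \<pi> = {1..n}\<close> \<open>length \<pi> = n\<close>
    by (metis atLeastAtMost_iff le_imp_less_Suc)
  have inj: "inj_on (entry \<pi>) (positions \<pi>)"
    using \<open>distinct \<pi>\<close> by (auto simp: inj_on_def entry_def nth_eq_iff_index_eq)
  note mesh = mesh_occurrence_1243 mesh_occurrence_1423 mesh_occurrence_2143 mesh_occurrence_4123
  show ?thesis
    \<comment> \<open>The four disjuncts now coincide with the right-hand sides of
      \<open>mesh\<close>, in the order of \<open>patterns_1243\<close>, so rewriting alone closes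
      the goal.\<close>
    unfolding avoids_bubble_iff [OF \<open>distinct \<pi>\<close>] relative_order_cases
    by (simp only: patterns_1243_def mesh_avoids_def ball_simps mesh [OF less inj] de_Morgan_disj simp_thms)
qed

theorem proposition3p3:
  shows "(\<forall>\<pi>\<in>perms. avoids (bubble \<pi>) [1,2,4,3] \<longleftrightarrow> (\<forall>P\<in>patterns_1243. mesh_avoids \<pi> P)) \<and>
         {\<pi> \<in> perms. bubble \<pi> \<in> Av [1,2,4,3]} = {\<pi> \<in> perms. \<forall>P\<in>patterns_1243. mesh_avoids \<pi> P}"
proof -
  \<comment> \<open>\<open>Av\<close> consists of permutations, so membership of
    \<open>bubble \<pi>\<close> in it reduces to avoidance only once this is known.\<close>
  have "bubble \<pi> \<in> perms" if "\<pi> \<in> perms" for \<pi>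
    using that mset_eq_setD [OF mset_bubble] mset_eq_imp_distinct_iff [OF mset_bubble]
    by (simp add: perms_def permutations_of_set_def)
  then show ?thesis
    using avoids_bubble_1243_iff_mesh by (auto simp: Av_def)
qed

end
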